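(* Let $d\geqslant 2$ be an integer and $\mathbb{K}=\mathbb{R}$ or $\mathbb{C}$. Let $H\neq\emptyset$ be a closed subset of $\mathbb{K}^d$ such that $H$ is a union of linear hyperplanes of $\mathbb{K}^d$. Then there exists a sequence $(f_n)$ of linear forms on $\mathbb{K}^d$ such that: 1) for all $x\notin H$, $\lim_{n\to\infty}|f_n(x)|=\infty$; 2) for all $x\in H$, $\liminf_{n\to\infty}|f_n(x)|=0$.
   Context: A linear hyperplane of $\mathbb{K}^d$ is a $\mathbb{K}$-linear subspace of dimension $d-1$ (so it contains $0$). *)

theory Defs
  imports "HOL-Analysis.Analysis"
begin

(* vec.subspace and vec.dim are taken over the scalar field 'k itself; the unqualified
   subspace and dim would be over the reals, also for complex vectors. *)
definition linear_hyperplane :: "('k::field ^ 'n::finite) set \<Rightarrow> bool" where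
  "linear_hyperplane W \<longleftrightarrow> vec.subspace W \<and> vec.dim W = CARD('n) - 1"

definition union_of_linear_hyperplanes :: "('k::field ^ 'n::finite) set \<Rightarrow> bool" where
  "union_of_linear_hyperplanes H \<longleftrightarrow>
     (\<exists>\<W>. (\<forall>W\<in>\<W>. linear_hyperplane W) \<and> H = \<Union>\<W>)"

definition linear_form :: "('k::field ^ 'n::finite \<Rightarrow> 'k) \<Rightarrow> bool" where
  "linear_form f \<longleftrightarrow> Vector_Spaces.linear (*s) (*) f"

end

theory Submission
  imports Defs
begin

text \<open>
  Let \<open>A\<close> be the set of unit vectors \<open>a\<close> whose hyperplane \<open>a \<cdot> x = 0\<close> lies in \<open>H\<close>. As \<open>H\<close> is closed, \<open>A\<close>
  is compact, so for \<open>x \<notin> H\<close> the number \<open>\<bar>a \<cdot> x\<bar>\<close> is bounded away from \<open>0\<close> uniformly in \<open>a \<in> A\<close>.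
  Hence any sequence of forms \<open>t\<^sub>n a\<^sub>n\<close> with \<open>a\<^sub>n \<in> A\<close> and \<open>t\<^sub>n \<rightarrow> \<infinity>\<close> satisfies the first condition. For
  the second one, let \<open>t\<^sub>n\<close> be constantly \<open>k\<close> while \<open>a\<^sub>n\<close> runs through a finite \<open>1/k\<^sup>2\<close>-net of \<open>A\<close>: if
  \<open>a \<cdot> x = 0\<close>, then some form of this block takes at \<open>x\<close> a value of size \<open>O(1/k)\<close>.
\<close>

text \<open>Neither factor is conjugated, so over the complex numbers this is bilinear rather than
  sesquilinear, and its values lie in the scalar field, unlike those of the real-valued
  \<open>inner\<close>.\<close>

definition dot :: "'k::comm_ring_1 ^ 'n::finite \<Rightarrow> 'k ^ 'n \<Rightarrow> 'k" where
  "dot a x = (\<Sum>i\<in>UNIV. a $ i * x $ i)"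

lemma dot_add_right: "dot a (x + y) = dot a x + dot a y"
  and dot_diff_left: "dot (a - b) x = dot a x - dot b x"
  and dot_diff_right: "dot a (x - y) = dot a x - dot a y"
  and dot_smult_left: "dot (c *s a) x = c * dot a x"
  and dot_smult_right: "dot a (c *s x) = c * dot a x"
  by (simp_all add: dot_def algebra_simps sum.distrib sum_subtractf sum_distrib_left)

lemma dot_axis: "dot a (axis i c) = a $ i * c"
  by (simp add: dot_def axis_def if_distrib [where f = "\<lambda>y. _ * y"] cong: if_cong)

lemma linear_form_dot: "linear_form (\<lambda>x. dot a x)"
  unfolding linear_form_def
  by unfold_locales (simp_all add: dot_add_right dot_smult_right algebra_simps)

section \<open>Linear forms and hyperplanes in terms of normal vectors\<close>

lemma linear_form_eq_dot:
  fixes f :: "'k::field ^ 'n::finite \<Rightarrow> 'k"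
  assumes "linear_form f"
  obtains a where "f = dot a"
proof
  interpret Vector_Spaces.linear "(*s)" "(*)" f
    using assms by (simp add: linear_form_def)
  show "f = dot (\<chi> i. f (axis i 1))"
  proof
    fix x
    have "f x = f (\<Sum>i\<in>UNIV. x $ i *s axis i 1)"
      by (simp add: basis_expansion)
    also have "\<dots> = dot (\<chi> i. f (axis i 1)) x"
      by (simp add: sum scale dot_def mult.commute)
    finally show "f x = dot (\<chi> i. f (axis i 1)) x" .
  qed
qed

text \<open>A basis \<open>B\<close> of \<open>W\<close> and one vector \<open>e\<close> outside
  \<open>W\<close> together form a basis of the whole space. The linear form that is 0 on
  \<open>B\<close> and 1 at \<open>e\<close> then has kernel \<open>W\<close>.\<close>

lemma linear_hyperplane_eq_kernel:
  fixes W :: "('k::field ^ 'n::finite) set"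
  assumes "linear_hyperplane W"
  obtains a where "a \<noteq> 0" and "W = {x. dot a x = 0}"
proof -
  interpret forms: vector_space_pair "(*s) :: 'k \<Rightarrow> 'k ^ 'n \<Rightarrow> 'k ^ 'n" "(*) :: 'k \<Rightarrow> 'k \<Rightarrow> 'k"
    by unfold_locales (simp_all add: algebra_simps)
  have sub: "vec.subspace W" and dim: "vec.dim W = CARD('n) - 1"
    using assms by (auto simp: linear_hyperplane_def)
  obtain B where B: "B \<subseteq> W" "vec.independent B" "W \<subseteq> vec.span B" "card B = vec.dim W"
    using vec.basis_exists by blast
  have span_B: "vec.span B = W"
    using B sub by (metis vec.span_minimal subset_antisym)
  \<comment> \<open>The truncated subtraction in \<open>linear_hyperplane\<close> is harmless here
    because \<open>CARD('n)\<close> is positive.\<close>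
  have "vec.dim W < CARD('n)"
    using dim by simp
  then have "W \<noteq> UNIV"
    using vec_dim_card less_irrefl by metis
  then obtain e where e: "e \<notin> W" by auto
  have ind: "vec.independent (insert e B)"
    using B e span_B by (simp add: vec.independent_insert)
  have "finite B"
    using B(2) vec.finiteI_independent by blast
  moreover have "e \<notin> B"
    using e B(1) by auto
  ultimately have "card (insert e B) = CARD('n)"
    using B(4) dim by simp
  then have "vec.span (insert e B) = UNIV"
    using vec.card_ge_dim_independent [of "insert e B" UNIV] ind
    by (auto simp: vec_dim_card simp del: vec.dim_UNIV)
  obtain f where f: "Vector_Spaces.linear (*s) (*) f" "\<forall>x\<in>insert e B. f x = (if x = e then 1 else 0)"
    using forms.linear_independent_extend [OF ind, of "\<lambda>x. if x = e then 1 else 0"] by blast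
  then obtain a where a: "f = dot a"
    using linear_form_eq_dot linear_form_def by metis
  have ae: "dot a e = 1" and "\<And>b. b \<in> B \<Longrightarrow> dot a b = 0"
    using f(2) \<open>e \<notin> B\<close> a by auto
  moreover have "vec.subspace {x. dot a x = 0}"
    by (auto intro!: vec.subspaceI simp: dot_add_right dot_smult_right) (simp add: dot_def)
  ultimately have W_ker: "W \<subseteq> {x. dot a x = 0}"
    using vec.span_minimal [of B "{x. dot a x = 0}"] span_B by blast
  \<comment> \<open>Modulo \<open>W\<close>, every vector is a multiple \<open>c *s e\<close>;
    applying \<open>dot a\<close> to a zero of the form forces \<open>c = 0\<close>.\<close>
  have "x \<in> W" if "dot a x = 0" for x
  proof -
    have "x \<in> vec.span (insert e B)"
      using \<open>vec.span (insert e B) = UNIV\<close> by simp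
    then obtain c where c: "x - c *s e \<in> W"
      using span_B by (auto simp: vec.span_insert)
    then have "c = 0"
      using W_ker that ae by (auto simp: dot_diff_right dot_smult_right)
    with c show ?thesis by simp
  qed
  moreover have "a \<noteq> 0"
    using ae by (auto simp: dot_def)
  ultimately show ?thesis
    using W_ker by (intro that) auto
qed

section \<open>Norm estimates and compactness of the set of unit normals\<close>

lemma norm_dot_le:
  fixes a x :: "'k::real_normed_field ^ 'n::finite"
  shows "norm (dot a x) \<le> norm a * (\<Sum>i\<in>UNIV. norm (x $ i))"
  unfolding dot_def sum_distrib_left
  by (intro sum_norm_le) (simp add: norm_mult mult_right_mono Finite_Cartesian_Product.norm_nth_le)

lemma tendsto_dot_left:
  fixes x :: "'k::real_normed_field ^ 'n::finite"
  assumes "(u \<longlongrightarrow> a) F"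
  shows "((\<lambda>n. dot (u n) x) \<longlongrightarrow> dot a x) F"
  unfolding dot_def by (intro tendsto_intros assms)

lemma norm_smult_vec:
  fixes a :: "'k::real_normed_field ^ 'n::finite"
  shows "norm (c *s a) = norm c * norm a"
  by (simp add: norm_vec_def norm_mult L2_set_right_distrib)

text \<open>The point is closedness: a zero of a limit form is itself a limit of zeros of the
  approximating forms, and these zeros lie in the closed set \<open>H\<close>.\<close>

lemma compact_unit_normals:
  fixes H :: "('k::{real_normed_field,heine_borel} ^ 'n::finite) set"
  assumes "closed H"
  shows "compact {a. norm a = 1 \<and> {x. dot a x = 0} \<subseteq> H}" (is "compact ?A")
proof -
  have "closed ?A"
    unfolding closed_sequential_limits
  proof (intro allI impI, elim conjE)
    fix u a assume u: "\<forall>n. u n \<in> ?A" and lim: "u \<longlonglongrightarrow> a"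
    have "(\<lambda>n. norm (u n)) \<longlonglongrightarrow> norm a"
      using lim by (rule tendsto_norm)
    then have norm_a: "norm a = 1"
      using u by (simp add: LIMSEQ_const_iff)
    then have "a \<noteq> 0" by auto
    then obtain i where i: "a $ i \<noteq> 0"
      by (auto simp: vec_eq_iff)
    have "x \<in> H" if x: "dot a x = 0" for x
    proof -
      \<comment> \<open>The projection of \<open>x\<close> to the kernel of \<open>u n\<close> along the \<open>i\<close>-th axis.\<close>
      define y where "y n = x - axis i (dot (u n) x / u n $ i)" for n
      have "(\<lambda>n. dot (u n) x / u n $ i) \<longlonglongrightarrow> dot a x / a $ i"
        by (intro tendsto_divide tendsto_dot_left tendsto_vec_nth lim i)
      then have "(\<lambda>n. y n $ j) \<longlonglongrightarrow> x $ j" for j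
        unfolding y_def axis_def using x
        by (cases "j = i") (auto dest: tendsto_diff [OF tendsto_const, of _ _ _ "x $ i"])
      then have "y \<longlonglongrightarrow> x"
        by (rule vec_tendstoI)
      \<comment> \<open>Where the divisor \<open>u n $ i\<close> is 0, the convention for division
        gives \<open>y n = x\<close>, which need not be a zero of \<open>u n\<close>; hence only
        eventual membership in \<open>H\<close> is claimed.\<close>
      moreover have "\<forall>\<^sub>F n in sequentially. u n $ i \<noteq> 0"
        using tendsto_imp_eventually_ne [OF tendsto_vec_nth [OF lim] i] .
      then have "\<forall>\<^sub>F n in sequentially. y n \<in> H"
      proof eventually_elim
        case (elim n)
        then have "dot (u n) (y n) = 0"
          by (simp add: y_def dot_diff_right dot_axis)
        with u show ?case by blast
      qed
      ultimately show ?thesis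
        using assms by (intro Lim_in_closed_set [of H y sequentially]) auto
    qed
    with norm_a show "a \<in> ?A" by auto
  qed
  moreover have "bounded ?A"
    by (auto intro: boundedI [of _ 1])
  ultimately show ?thesis
    by (simp add: compact_eq_bounded_closed)
qed

section \<open>Lower limits and the enumeration of finite blocks\<close>

lemma liminf_ereal_eq_0I:
  fixes g :: "nat \<Rightarrow> real"
  assumes "\<And>n. g n \<ge> 0" and "\<And>e. e > 0 \<Longrightarrow> \<exists>\<^sub>F n in sequentially. g n \<le> e"
  shows "liminf (\<lambda>n. ereal (g n)) = 0"
proof (rule antisym)
  show "liminf (\<lambda>n. ereal (g n)) \<ge> 0"
    using assms(1) by (intro Liminf_bounded) simp
  show "liminf (\<lambda>n. ereal (g n)) \<le> 0"
  proof (rule ccontr)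
    assume "\<not> ?thesis"
    then have "0 < liminf (\<lambda>n. ereal (g n))" by simp
    then obtain e where e: "0 < ereal e" "ereal e < liminf (\<lambda>n. ereal (g n))"
      using ereal_dense2 by blast
    have "\<forall>\<^sub>F n in sequentially. ereal e < ereal (g n)"
      using e(2) by (rule less_LiminfD)
    moreover have "\<exists>\<^sub>F n in sequentially. g n \<le> e"
      using assms(2) e(1) by simp
    ultimately show False
      by (simp add: frequently_def not_le)
  qed
qed

text \<open>The pairs \<open>(k, b)\<close> with \<open>b \<in> F k\<close> form a countably
  infinite set, and any bijective enumeration serves; the blocks need not appear in order. Only
  finitely many pairs have first component below a given bound, so \<open>t\<close> tends to
  infinity. Every pair occurs, so a property with a witness in each block holds at infinitely many
  indices.\<close>

lemma enumerate_blocks: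
  fixes F :: "nat \<Rightarrow> 'a set"
  assumes "\<And>k. finite (F k)" and "\<And>k. F k \<noteq> {}"
  obtains t :: "nat \<Rightarrow> nat" and a :: "nat \<Rightarrow> 'a"
  where "\<And>n. a n \<in> F (t n)" and "filterlim t at_top sequentially"
    and "\<And>P. (\<And>k. \<exists>b\<in>F k. P k b) \<Longrightarrow>
           \<forall>k. \<exists>\<^sub>F n in sequentially. k \<le> t n \<and> P (t n) (a n)"
proof -
  define S where "S = Sigma UNIV F"
  have "countable S"
    unfolding S_def using assms(1) by (intro countable_SIGMA) (auto intro: countable_finite)
  moreover have "infinite S"
  proof
    assume "finite S"
    then have "finite (fst ` S)" by simp
    moreover have "fst ` S = UNIV"
      using assms(2) by (force simp: S_def image_iff)
    ultimately show False by simp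
  qed
  ultimately have bij: "bij_betw (from_nat_into S) UNIV S"
    by (simp add: bij_betw_from_nat_into)
  define t where "t n = fst (from_nat_into S n)" for n
  define a where "a n = snd (from_nat_into S n)" for n
  have enum: "from_nat_into S n = (t n, a n)" for n
    by (simp add: t_def a_def)
  have range: "(t n, a n) \<in> S" for n
    using bij unfolding enum [symmetric] by (auto simp: bij_betw_def)
  have fin: "finite {n. t n < k}" for k
  proof (rule inj_on_finite [of "from_nat_into S" _ "Sigma {..<k} F"])
    show "inj_on (from_nat_into S) {n. t n < k}"
      using bij by (auto simp: bij_betw_def intro: inj_on_subset)
    show "from_nat_into S ` {n. t n < k} \<subseteq> Sigma {..<k} F"
    proof (rule image_subsetI)
      fix n assume "n \<in> {n. t n < k}"
      with range [of n] show "from_nat_into S n \<in> Sigma {..<k} F"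
        unfolding enum by (simp add: S_def)
    qed
    show "finite (Sigma {..<k} F)"
      using assms(1) by auto
  qed
  show ?thesis
  proof
    show "a n \<in> F (t n)" for n
      using range by (simp add: S_def)
    have "\<forall>\<^sub>F n in sequentially. k \<le> t n" for k
      using fin [of k] by (simp flip: cofinite_eq_sequentially add: eventually_cofinite not_le)
    then show "filterlim t at_top sequentially"
      by (simp add: filterlim_at_top)
    show "\<forall>k. \<exists>\<^sub>F n in sequentially. k \<le> t n \<and> P (t n) (a n)" if "\<And>k. \<exists>b\<in>F k. P k b" for P
    proof
      fix k
      have hit: "\<exists>n. t n = j \<and> P (t n) (a n)" for j
      proof -
        obtain b where "b \<in> F j" "P j b" using \<open>\<exists>b\<in>F j. P j b\<close> by blast
        then have "(j, b) \<in> range (from_nat_into S)"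
          using bij by (simp add: bij_betw_def S_def)
        then obtain n where "from_nat_into S n = (j, b)" by force
        with \<open>P j b\<close> show ?thesis
          by (auto simp: enum)
      qed
      let ?N = "{n. k \<le> t n \<and> P (t n) (a n)}"
      \<comment> \<open>Each block from \<open>k\<close> on contributes an index, so
        \<open>?N\<close> has an infinite image under \<open>t\<close>.\<close>
      have "{k..} \<subseteq> t ` ?N"
      proof
        fix j assume "j \<in> {k..}"
        with hit [of j] show "j \<in> t ` ?N" by force
      qed
      then have "infinite ?N"
        using infinite_Ici [of k] finite_surj by blast
      then show "\<exists>\<^sub>F n in sequentially. k \<le> t n \<and> P (t n) (a n)"
        by (simp flip: cofinite_eq_sequentially add: frequently_cofinite)
    qed
  qed
qed

section \<open>Construction of the sequence of forms\<close>

lemma linear_forms_separating_union_of_hyperplanes: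
  fixes H :: "('k::{real_normed_field,heine_borel} ^ 'n::finite) set"
  assumes "H \<noteq> {}" and "closed H" and "union_of_linear_hyperplanes H"
  shows "\<exists>f :: nat \<Rightarrow> 'k ^ 'n \<Rightarrow> 'k.
           (\<forall>n. linear_form (f n)) \<and>
           (\<forall>x. x \<notin> H \<longrightarrow> filterlim (\<lambda>n. norm (f n x)) at_top sequentially) \<and>
           (\<forall>x\<in>H. liminf (\<lambda>n. ereal (norm (f n x))) = 0)"
proof -
  define A where "A = {a. norm a = 1 \<and> {x. dot a x = 0} \<subseteq> H}"
  have cpt: "compact A"
    unfolding A_def using assms(2) by (rule compact_unit_normals)
  have normal: "\<exists>a\<in>A. dot a x = 0" if "x \<in> H" for x
  proof -
    obtain \<W> where "\<forall>W\<in>\<W>. linear_hyperplane W" and "H = \<Union>\<W>"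
      using assms(3) by (auto simp: union_of_linear_hyperplanes_def)
    with that obtain W where W: "linear_hyperplane W" "x \<in> W" "W \<subseteq> H"
      by (meson UnionE Union_upper)
    obtain a where a: "a \<noteq> 0" "W = {x. dot a x = 0}"
      using linear_hyperplane_eq_kernel [OF W(1)] by blast
    \<comment> \<open>Rescaling the normal to length 1 leaves its kernel unchanged.\<close>
    have "of_real (inverse (norm a)) *s a \<in> A"
      using a W(3) by (simp add: A_def norm_smult_vec dot_smult_left norm_inverse)
    moreover have "dot (of_real (inverse (norm a)) *s a) x = 0"
      using a W(2) by (simp add: dot_smult_left)
    ultimately show ?thesis by blast
  qed
  have "A \<noteq> {}"
    using normal assms(1) by auto
  \<comment> \<open>The radius is squared so that it still beats the factor \<open>Suc k\<close> by
    which the forms of block \<open>k\<close> are scaled; \<open>Suc\<close> keeps the radius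
    meaningful for \<open>k = 0\<close>.\<close>
  have "\<exists>F. finite F \<and> F \<subseteq> A \<and> A \<subseteq> (\<Union>b\<in>F. ball b (1 / (real (Suc k))\<^sup>2))" for k
    using cpt by (intro seq_compact_imp_totally_bounded [rule_format])
      (auto simp: compact_eq_seq_compact_metric)
  then obtain F where F: "\<And>k. finite (F k)" "\<And>k. F k \<subseteq> A"
    "\<And>k. A \<subseteq> (\<Union>b\<in>F k. ball b (1 / (real (Suc k))\<^sup>2))"
    by metis
  have "F k \<noteq> {}" for k
    using F(3) [of k] \<open>A \<noteq> {}\<close> by auto
  with F(1) obtain t a where aF: "\<And>n. a n \<in> F (t n)" and t: "filterlim t at_top sequentially"
    and block: "\<And>P. (\<And>k. \<exists>b\<in>F k. P k b) \<Longrightarrow>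
           \<forall>k. \<exists>\<^sub>F n in sequentially. k \<le> t n \<and> P (t n) (a n)"
    by (rule enumerate_blocks [of F]) metis+
  define f where "f n x = dot (of_nat (Suc (t n)) *s a n) x" for n x
  have norm_f: "norm (f n x) = real (Suc (t n)) * norm (dot (a n) x)" for n x
    unfolding f_def dot_smult_left norm_mult norm_of_nat ..
  have "filterlim (\<lambda>n. norm (f n x)) at_top sequentially" if x: "x \<notin> H" for x
  proof -
    \<comment> \<open>The minimum over the compact set \<open>A\<close> is attained, and it is
      positive because a normal in \<open>A\<close> vanishing at \<open>x\<close> would put
      \<open>x\<close> into \<open>H\<close>.\<close>
    have "continuous_on A (\<lambda>a. norm (dot a x))"
      by (intro continuous_on_norm) (auto simp: continuous_on intro: tendsto_dot_left)
    then obtain c where c: "c \<in> A" "\<And>b. b \<in> A \<Longrightarrow> norm (dot c x) \<le> norm (dot b x)"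
      using continuous_attains_inf [OF cpt \<open>A \<noteq> {}\<close>] by blast
    have "norm (dot c x) > 0"
      using c(1) x by (auto simp: A_def)
    moreover have "filterlim (\<lambda>n. real (t n)) at_top sequentially"
      using filterlim_compose [OF filterlim_real_sequentially t] .
    ultimately have "filterlim (\<lambda>n. norm (dot c x) * real (t n)) at_top sequentially"
      by (intro filterlim_tendsto_pos_mult_at_top [OF tendsto_const])
    moreover have "norm (dot c x) * real (t n) \<le> norm (f n x)" for n
      unfolding norm_f using c(2) [of "a n"] aF [of n] F(2)
      by (subst mult.commute, intro mult_mono) auto
    ultimately show ?thesis
      by (auto intro: filterlim_at_top_mono)
  qed
  moreover have "liminf (\<lambda>n. ereal (norm (f n x))) = 0" if "x \<in> H" for x
  proof (rule liminf_ereal_eq_0I)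
    define C where "C = (\<Sum>i\<in>UNIV. norm (x $ i))"
    have "C \<ge> 0" unfolding C_def by (intro sum_nonneg) simp
    fix e :: real assume "e > 0"
    \<comment> \<open>From block \<open>m\<close> on, the final bound
      \<open>C / real (Suc (t n))\<close> is at most \<open>e\<close>.\<close>
    obtain m :: nat where m: "C / e < real m"
      using reals_Archimedean2 by blast
    obtain c where c: "c \<in> A" "dot c x = 0"
      using normal \<open>x \<in> H\<close> by blast
    have "\<exists>b\<in>F k. norm (dot b x) \<le> C / (real (Suc k))\<^sup>2" for k
    proof -
      obtain b where b: "b \<in> F k" "dist b c < 1 / (real (Suc k))\<^sup>2"
        using F(3) [of k] c(1) by (auto simp del: of_nat_Suc)
      have "norm (dot b x) = norm (dot (b - c) x)"
        by (simp add: dot_diff_left c(2))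
      also have "\<dots> \<le> dist b c * C"
        unfolding C_def dist_norm by (rule norm_dot_le)
      also have "\<dots> \<le> 1 / (real (Suc k))\<^sup>2 * C"
        using b(2) \<open>C \<ge> 0\<close> by (intro mult_right_mono) simp_all
      finally show ?thesis
        using b(1) by auto
    qed
    then have "\<exists>\<^sub>F n in sequentially. m \<le> t n \<and> norm (dot (a n) x) \<le> C / (real (Suc (t n)))\<^sup>2"
      using block [of "\<lambda>k b. norm (dot b x) \<le> C / (real (Suc k))\<^sup>2"] by blast
    then show "\<exists>\<^sub>F n in sequentially. norm (f n x) \<le> e"
    proof (rule frequently_elim1, elim conjE)
      fix n assume n: "m \<le> t n" "norm (dot (a n) x) \<le> C / (real (Suc (t n)))\<^sup>2"
      have "norm (f n x) \<le> real (Suc (t n)) * (C / (real (Suc (t n)))\<^sup>2)"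
        unfolding norm_f using n(2) by (rule mult_left_mono) simp
      also have "\<dots> = C / real (Suc (t n))"
        by (simp add: power2_eq_square del: of_nat_Suc)
      also have "\<dots> \<le> e"
      proof -
        have "C < e * real m"
          using m \<open>e > 0\<close> by (simp add: field_simps)
        also have "\<dots> \<le> e * real (Suc (t n))"
          using n(1) \<open>e > 0\<close> by (intro mult_left_mono) auto
        finally show ?thesis
          by (simp add: pos_divide_le_eq del: of_nat_Suc)
      qed
      finally show "norm (f n x) \<le> e" .
    qed
  qed simp
  moreover have "linear_form (f n)" for n
    unfolding f_def by (rule linear_form_dot)
  ultimately show ?thesis by blast
qed

text \<open>The real and the complex numbers are both normed fields with the Heine-Borel property,
  so the general construction covers each of them.\<close>

theorem proposition2p1:
  assumes "CARD('n::finite) \<ge> 2"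
  shows
    "(\<forall>H :: (real ^ 'n) set.
        H \<noteq> {} \<longrightarrow> closed H \<longrightarrow> union_of_linear_hyperplanes H \<longrightarrow>
        (\<exists>f :: nat \<Rightarrow> real ^ 'n \<Rightarrow> real.
           (\<forall>n. linear_form (f n)) \<and>
           (\<forall>x. x \<notin> H \<longrightarrow> filterlim (\<lambda>n. norm (f n x)) at_top sequentially) \<and>
           (\<forall>x\<in>H. liminf (\<lambda>n. ereal (norm (f n x))) = 0)))
     \<and>
     (\<forall>H :: (complex ^ 'n) set.
        H \<noteq> {} \<longrightarrow> closed H \<longrightarrow> union_of_linear_hyperplanes H \<longrightarrow>
        (\<exists>f :: nat \<Rightarrow> complex ^ 'n \<Rightarrow> complex.
           (\<forall>n. linear_form (f n)) \<and>
           (\<forall>x. x \<notin> H \<longrightarrow> filterlim (\<lambda>n. norm (f n x)) at_top sequentially) \<and>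
           (\<forall>x\<in>H. liminf (\<lambda>n. ereal (norm (f n x))) = 0)))"
  by (intro conjI allI impI linear_forms_separating_union_of_hyperplanes)

end
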